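(* Let $n\ge1$. In the algebra $\mathcal T_n$ (that is, on genuine projective representations of $\tilde S_n$), the Casimir element satisfies $$\Omega_{\tilde S_n}=\frac12\sum_{k=1}^n M_k^2,$$ where $M_1,\dots,M_n$ are the Jucys-Murphy elements of $\mathcal T_n$.
   Context: $\mathcal T_n$ is the unital associative $\mathbb C$-algebra generated by $\tau_1,\dots,\tau_{n-1}$ with $\tau_i^2=1$, $(\tau_i\tau_{j})^{2}=-1$ if $|i-j|>1$, and $(\tau_i\tau_{i+1})^3=1$. It is $\mathbb C[\tilde S_n]/(z+1)$, where $\tilde S_n$ is the corresponding double cover of $S_n$ with central element $z$. Let $\xi_1,\dots,\xi_n$ be an orthonormal basis of an $n$-dimensional space with form $(\ ,\ )$, $\Phi^+=\{\xi_i-\xi_j: i<j\}$ the positive roots of type $A_{n-1}$, $s_\alpha$ the reflection in $\alpha$, and $|\alpha|=\sqrt{(\alpha,\alpha)}=\sqrt2$. For $\alpha=\xi_i-\xi_j\in\Phi^+$ the pseudo-transposition is $$\tau_\alpha=(-1)^{j-i-1}\tau_{j-1}\cdots\tau_{i+1}\tau_i\tau_{i+1}\cdots\tau_{j-1}\in\mathcal T_n .$$ The Jucys-Murphy elements are $M_k=\sum_{\alpha\in\Phi^+:\,(\alpha,\xi_k)<0}\tau_\alpha=\sum_{j<k}\tau_{\xi_j-\xi_k}$ (so $M_1=0$). The Casimir element (its image in $\mathcal T_n$) is $$\Omega_{\tilde S_n}=\frac14\sum_{\substack{\alpha,\beta\in\Phi^+\\ s_\alpha(\beta)<0}}|\alpha||\beta|\,\tau_\alpha\tau_\beta,$$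 where $s_\alpha(\beta)<0$ means $-s_\alpha(\beta)\in\Phi^+$. *)

theory Defs
  imports
    Complex_Main
    "HOL-Library.Poly_Mapping"
    "HOL-Algebra.QuotRing"
    "Jordan_Normal_Form.Matrix"
begin

section \<open>The free associative algebra\<close>

text \<open>
  With words under concatenation as an additive (non-commutative) monoid, the convolution product
  of HOL-Library.Poly_Mapping turns the finitely supported functions from words to complex numbers
  into the free unital associative algebra.
\<close>

datatype 'g free_monoid = Word (letters: "'g list")

instantiation free_monoid :: (type) monoid_add
begin

definition zero_free_monoid :: "'a free_monoid" where
  "0 = Word []"

definition plus_free_monoid :: "'a free_monoid \<Rightarrow> 'a free_monoid \<Rightarrow> 'a free_monoid" where
  "u + v = Word (letters u @ letters v)"

instance
  by standard (simp_all add: zero_free_monoid_def plus_free_monoid_def)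

end

type_synonym free_poly = "nat free_monoid \<Rightarrow>\<^sub>0 complex"

definition gen_var :: "nat \<Rightarrow> free_poly" where
  "gen_var i = Poly_Mapping.single (Word [i]) 1"

definition const :: "complex \<Rightarrow> free_poly" where
  "const c = Poly_Mapping.single 0 c"

definition free_algebra :: "nat set \<Rightarrow> free_poly ring" where
  "free_algebra G =
     \<lparr>carrier = {p. \<forall>w \<in> Poly_Mapping.keys p. set (letters w) \<subseteq> G}, monoid.mult = (*), one = 1, zero = 0, add = (+)\<rparr>"


section \<open>The algebra $\mathcal T_n$\<close>

text \<open>A relation $a = b$ is represented by the element $a - b$ of the free algebra.\<close>

definition relators :: "nat \<Rightarrow> free_poly set" where
  "relators n =
     {gen_var i ^ 2 - 1 | i. 1 \<le> i \<and> i < n}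
   \<union> {(gen_var i * gen_var j) ^ 2 + 1 | i j.
        1 \<le> i \<and> i < n \<and> 1 \<le> j \<and> j < n \<and> \<bar>int i - int j\<bar> > 1}
   \<union> {(gen_var i * gen_var (i + 1)) ^ 3 - 1 | i. 1 \<le> i \<and> i + 1 < n}"

definition rel_ideal :: "nat \<Rightarrow> free_poly set" where
  "rel_ideal n = genideal (free_algebra {1..<n}) (relators n)"

definition T_ring :: "nat \<Rightarrow> free_poly set ring" where
  "T_ring n = free_algebra {1..<n} Quot rel_ideal n"

definition coset :: "nat \<Rightarrow> free_poly \<Rightarrow> free_poly set" where
  "coset n p = rel_ideal n +>\<^bsub>free_algebra {1..<n}\<^esub> p"

text \<open>
  The record type \<open>module\<close> is used to have the scalar multiplication at hand; the locale
  \<open>algebra\<close> of HOL-Algebra is not applicable, since it assumes commutativity.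
\<close>

definition T :: "nat \<Rightarrow> (complex, free_poly set) module" where
  "T n = ring.extend (T_ring n)
     (module.fields (\<lambda>c X. coset n (const c) \<otimes>\<^bsub>T_ring n\<^esub> X))"

definition tau :: "nat \<Rightarrow> nat \<Rightarrow> free_poly set" where
  "tau n i = coset n (gen_var i)"

definition list_prod :: "nat \<Rightarrow> free_poly set list \<Rightarrow> free_poly set" where
  "list_prod n xs = foldr (\<lambda>x y. x \<otimes>\<^bsub>T n\<^esub> y) xs \<one>\<^bsub>T n\<^esub>"


section \<open>Roots of type $A_{n-1}$\<close>

text \<open>
  The vectors $\xi_1,\dots,\xi_n$ are the values of \<open>\<xi>\<close> on \<open>{1..n}\<close>.  Since there are \<open>n\<close> of them
  in an \<open>n\<close>-dimensional space, orthonormality alone makes them a basis.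
\<close>

definition orthonormal_basis :: "nat \<Rightarrow> (nat \<Rightarrow> real vec) \<Rightarrow> bool" where
  "orthonormal_basis n \<xi> \<longleftrightarrow>
     (\<forall>i \<in> {1..n}. \<xi> i \<in> carrier_vec n) \<and>
     (\<forall>i \<in> {1..n}. \<forall>j \<in> {1..n}. \<xi> i \<bullet> \<xi> j = (if i = j then 1 else 0))"

definition pos_roots :: "nat \<Rightarrow> (nat \<Rightarrow> real vec) \<Rightarrow> real vec set" where
  "pos_roots n \<xi> = {\<xi> i - \<xi> j | i j. 1 \<le> i \<and> i < j \<and> j \<le> n}"

definition reflection :: "real vec \<Rightarrow> real vec \<Rightarrow> real vec" where
  "reflection \<alpha> v = v - (2 * (v \<bullet> \<alpha>) / (\<alpha> \<bullet> \<alpha>)) \<cdot>\<^sub>v \<alpha>"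

definition root_length :: "real vec \<Rightarrow> real" where
  "root_length \<alpha> = sqrt (\<alpha> \<bullet> \<alpha>)"


section \<open>Pseudo-transpositions, Jucys-Murphy elements and the Casimir element\<close>

text \<open>
  For \<open>i < j\<close> the list \<open>rev [i..<j] @ [i + 1..<j]\<close> is
  $j-1, \dots, i+1, i, i+1, \dots, j-1$.
\<close>

definition pseudo_transposition :: "nat \<Rightarrow> nat \<Rightarrow> nat \<Rightarrow> free_poly set" where
  "pseudo_transposition n i j =
     (-1) ^ (j - i - 1) \<odot>\<^bsub>T n\<^esub> list_prod n (map (tau n) (rev [i..<j] @ [i + 1..<j]))"

text \<open>
  The root $\alpha = \xi_i - \xi_j$ determines $i$ and $j$; see \<open>tau_root_eq\<close> below.
\<close>

definition tau_root :: "nat \<Rightarrow> (nat \<Rightarrow> real vec) \<Rightarrow> real vec \<Rightarrow> free_poly set" where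
  "tau_root n \<xi> \<alpha> =
     (THE t. \<exists>i j. 1 \<le> i \<and> i < j \<and> j \<le> n \<and> \<alpha> = \<xi> i - \<xi> j \<and> t = pseudo_transposition n i j)"

definition jucys_murphy :: "nat \<Rightarrow> (nat \<Rightarrow> real vec) \<Rightarrow> nat \<Rightarrow> free_poly set" where
  "jucys_murphy n \<xi> k =
     (\<Oplus>\<^bsub>T n\<^esub> \<alpha> \<in> {\<alpha> \<in> pos_roots n \<xi>. \<alpha> \<bullet> \<xi> k < 0}. tau_root n \<xi> \<alpha>)"

definition casimir :: "nat \<Rightarrow> (nat \<Rightarrow> real vec) \<Rightarrow> free_poly set" where
  "casimir n \<xi> =
     (1 / 4) \<odot>\<^bsub>T n\<^esub>
       (\<Oplus>\<^bsub>T n\<^esub> p \<in> {(\<alpha>, \<beta>). \<alpha> \<in> pos_roots n \<xi> \<and> \<beta> \<in> pos_roots n \<xi> \<and>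
                             - reflection \<alpha> \<beta> \<in> pos_roots n \<xi>}.
          complex_of_real (root_length (fst p) * root_length (snd p)) \<odot>\<^bsub>T n\<^esub>
            (tau_root n \<xi> (fst p) \<otimes>\<^bsub>T n\<^esub> tau_root n \<xi> (snd p)))"


section \<open>Basic facts\<close>

lemma orthonormal_basis_diff_eqD:
  assumes on: "orthonormal_basis n \<xi>"
    and ij: "1 \<le> i" "i < j" "j \<le> n" and kl: "1 \<le> k" "k < l" "l \<le> n"
    and eq: "\<xi> i - \<xi> j = \<xi> k - \<xi> l"
  shows "i = k \<and> j = l"
proof -
  have car: "\<xi> m \<in> carrier_vec n" if "m \<in> {1..n}" for m
    using on that by (auto simp: orthonormal_basis_def)
  have ip: "(\<xi> a - \<xi> b) \<bullet> \<xi> m = (if a = m then 1 else 0) - (if b = m then 1 else 0)"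
    if "a \<in> {1..n}" "b \<in> {1..n}" "m \<in> {1..n}" for a b m
    using on that car by (subst minus_scalar_prod_distrib[of _ n]) (auto simp: orthonormal_basis_def)
  have "(1::real) = (if k = i then 1 else 0) - (if l = i then 1 else 0)"
    using ip[of i j i] ip[of k l i] ij kl by (simp add: eq del: One_nat_def)
  moreover have "(- 1::real) = (if k = j then 1 else 0) - (if l = j then 1 else 0)"
    using ip[of i j j] ip[of k l j] ij kl by (simp add: eq del: One_nat_def)
  ultimately show ?thesis
    by (simp split: if_splits)
qed

lemma tau_root_eq:
  assumes "orthonormal_basis n \<xi>" "1 \<le> i" "i < j" "j \<le> n"
  shows "tau_root n \<xi> (\<xi> i - \<xi> j) = pseudo_transposition n i j"
  unfolding tau_root_def
  by (rule the_equality) (use assms orthonormal_basis_diff_eqD[OF assms] in blast)+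

lemma ring_free_algebra: "ring (free_algebra G)"
proof -
  let ?F = "free_algebra G"
  have carrier: "p \<in> carrier ?F \<longleftrightarrow> (\<forall>w \<in> Poly_Mapping.keys p. set (letters w) \<subseteq> G)" for p
    by (simp add: free_algebra_def)
  have ops: "x \<oplus>\<^bsub>?F\<^esub> y = x + y" "x \<otimes>\<^bsub>?F\<^esub> y = x * y" "\<zero>\<^bsub>?F\<^esub> = 0" "\<one>\<^bsub>?F\<^esub> = 1" for x y
    by (simp_all add: free_algebra_def)
  have zero: "0 \<in> carrier ?F" by (simp add: carrier)
  have one: "1 \<in> carrier ?F" by (simp add: carrier zero_free_monoid_def)
  have mult: "p * q \<in> carrier ?F" if p: "p \<in> carrier ?F" and q: "q \<in> carrier ?F" for p q
    unfolding carrier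
  proof
    fix w assume "w \<in> Poly_Mapping.keys (p * q)"
    then obtain u v where "u \<in> Poly_Mapping.keys p" "v \<in> Poly_Mapping.keys q" "w = u + v"
      using keys_mult[of p q] by blast
    with p q show "set (letters w) \<subseteq> G"
      unfolding carrier by (simp add: plus_free_monoid_def)
  qed
  have add: "p + q \<in> carrier ?F" if p: "p \<in> carrier ?F" and q: "q \<in> carrier ?F" for p q
    using p q Poly_Mapping.keys_add[of p q] unfolding carrier by blast
  have uminus: "- p \<in> carrier ?F" if p: "p \<in> carrier ?F" for p
    using p unfolding carrier by simp
  show ?thesis
  proof (rule ringI)
    show "abelian_group ?F"
    proof (rule abelian_groupI)
      fix p assume "p \<in> carrier ?F"
      then show "\<exists>q \<in> carrier ?F. q \<oplus>\<^bsub>?F\<^esub> p = \<zero>\<^bsub>?F\<^esub>"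
        by (intro bexI[of _ "- p"] uminus) (simp_all add: ops)
    qed (simp_all add: ops add zero add.assoc add.commute)
    show "monoid ?F"
      by (rule monoidI) (simp_all add: ops mult one mult.assoc)
  qed (simp_all add: ops ring_distribs)
qed

lemma const_in_carrier: "const c \<in> carrier (free_algebra G)"
  by (simp add: const_def free_algebra_def zero_free_monoid_def)

lemma gen_var_in_carrier: "i \<in> G \<Longrightarrow> gen_var i \<in> carrier (free_algebra G)"
  by (simp add: gen_var_def free_algebra_def)

lemma relators_subset: "relators n \<subseteq> carrier (free_algebra {1..<n})"
proof -
  interpret F: ring "free_algebra {1..<n}" by (rule ring_free_algebra)
  let ?C = "carrier (free_algebra {1..<n})"
  have mult: "p * q \<in> ?C" if "p \<in> ?C" "q \<in> ?C" for p q
    using F.m_closed[OF that] by (simp add: free_algebra_def)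
  have one: "1 \<in> ?C" using F.one_closed by (simp add: free_algebra_def)
  have add: "p + q \<in> ?C" if "p \<in> ?C" "q \<in> ?C" for p q
    using F.a_closed[OF that] by (simp add: free_algebra_def)
  have "- 1 \<in> ?C" using one by (simp add: free_algebra_def)
  then have minus: "p - 1 \<in> ?C" if "p \<in> ?C" for p
    using add[OF that] by fastforce
  show ?thesis
    unfolding relators_def power2_eq_square power3_eq_cube
    by (auto simp del: One_nat_def intro!: mult minus add one gen_var_in_carrier)
qed

lemma ideal_rel_ideal: "ideal (rel_ideal n) (free_algebra {1..<n})"
  unfolding rel_ideal_def
  by (rule ring.genideal_ideal[OF ring_free_algebra relators_subset])

lemma ring_T_ring: "ring (T_ring n)"
  unfolding T_ring_def by (rule ideal.quotient_is_ring[OF ideal_rel_ideal])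

lemma T_simps:
  "carrier (T n) = carrier (T_ring n)" "monoid.mult (T n) = monoid.mult (T_ring n)"
  "one (T n) = one (T_ring n)" "zero (T n) = zero (T_ring n)" "add (T n) = add (T_ring n)"
  "smult (T n) c X = coset n (const c) \<otimes>\<^bsub>T_ring n\<^esub> X"
  by (simp_all add: T_def ring.defs module.defs)

lemma ring_T: "ring (T n)"
proof -
  interpret R: ring "T_ring n" by (rule ring_T_ring)
  show ?thesis
  proof (rule ringI)
    show "abelian_group (T n)"
      by (rule abelian_groupI) (use R.l_neg R.a_inv_closed in \<open>auto simp: T_simps R.a_ac\<close>)
    show "monoid (T n)" by (rule monoidI) (simp_all add: T_simps R.m_assoc)
  qed (simp_all add: T_simps R.l_distr R.r_distr)
qed

lemma coset_hom: "coset n \<in> Ring.ring_hom (free_algebra {1..<n}) (T_ring n)"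
  unfolding coset_def T_ring_def by (rule ideal.rcos_ring_hom[OF ideal_rel_ideal])

lemma smult_coset:
  assumes "p \<in> carrier (free_algebra {1..<n})"
  shows "c \<odot>\<^bsub>T n\<^esub> coset n p = coset n (const c * p)"
  using ring_hom_mult[OF coset_hom const_in_carrier assms, of c] by (simp add: T_simps free_algebra_def)

lemma coset_eq_iff:
  assumes "p \<in> carrier (free_algebra {1..<n})" "q \<in> carrier (free_algebra {1..<n})"
  shows "coset n p = coset n q \<longleftrightarrow> p - q \<in> rel_ideal n"
proof -
  interpret I: ideal "rel_ideal n" "free_algebra {1..<n}" by (rule ideal_rel_ideal)
  have "\<ominus>\<^bsub>free_algebra {1..<n}\<^esub> q = - q"
    using assms(2) by (intro I.minus_equality) (simp_all add: free_algebra_def)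
  then have "p \<ominus>\<^bsub>free_algebra {1..<n}\<^esub> q = p - q"
    by (simp add: a_minus_def free_algebra_def)
  then show ?thesis
    using I.quotient_eq_iff_same_a_r_cos[OF ideal_rel_ideal assms] by (auto simp: coset_def)
qed

lemma coset_mult:
  assumes "p \<in> carrier (free_algebra {1..<n})" "q \<in> carrier (free_algebra {1..<n})"
  shows "coset n p \<otimes>\<^bsub>T n\<^esub> coset n q = coset n (p * q)"
  using ring_hom_mult[OF coset_hom assms] by (simp add: T_simps free_algebra_def)

lemma coset_one: "\<one>\<^bsub>T n\<^esub> = coset n 1"
  using ring_hom_one[OF coset_hom[of n]] by (simp add: T_simps free_algebra_def)

lemma tau_closed:
  assumes "1 \<le> i" "i < n"
  shows "tau n i \<in> carrier (T n)"
  using ring_hom_closed[OF coset_hom gen_var_in_carrier, of i n] assms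
  by (simp add: tau_def T_simps)

lemma tau_square:
  assumes "1 \<le> i" "i < n"
  shows "tau n i \<otimes>\<^bsub>T n\<^esub> tau n i = \<one>\<^bsub>T n\<^esub>"
proof -
  interpret F: ring "free_algebra {1..<n}" by (rule ring_free_algebra)
  have i: "gen_var i \<in> carrier (free_algebra {1..<n})"
    using assms by (intro gen_var_in_carrier) simp
  have "gen_var i * gen_var i - 1 \<in> relators n"
    using assms unfolding relators_def power2_eq_square by blast
  then have "gen_var i * gen_var i - 1 \<in> rel_ideal n"
    unfolding rel_ideal_def using F.genideal_self[OF relators_subset] by blast
  moreover have "gen_var i * gen_var i \<in> carrier (free_algebra {1..<n})"
    using F.m_closed[OF i i] by (simp add: free_algebra_def)
  moreover have "1 \<in> carrier (free_algebra {1..<n})"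
    using F.one_closed by (simp add: free_algebra_def)
  ultimately show ?thesis
    by (simp add: tau_def coset_mult[OF i i] coset_one coset_eq_iff del: One_nat_def)
qed

end

theory Submission
  imports Defs
begin

text \<open>
  Since all roots have length $\sqrt 2$, the Casimir element is half the sum of
  $\tau_\alpha\tau_\beta$ over the pairs with $s_\alpha(\beta)<0$.  These are the pairs
  $(\xi_i-\xi_j, \xi_k-\xi_j)$ with $i \le k < j$ and $(\xi_i-\xi_j, \xi_i-\xi_l)$ with
  $i < l < j$.  Writing $\tau_{ij}$ for $\tau_{\xi_i-\xi_j}$, the identity
  $\tau_{ij}\tau_{il} = \tau_{lj}\tau_{ij}$ for $i<l<j$ turns the latter products into those
  that are missing from the expansion of $\sum_j M_j^2$.
\<close>

section \<open>Iterated finite sums and products of finite sums\<close>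

lemma (in abelian_monoid) finsum_Sigma:
  assumes "finite A" "\<And>x. x \<in> A \<Longrightarrow> finite (B x)"
    and "\<And>x y. x \<in> A \<Longrightarrow> y \<in> B x \<Longrightarrow> f (x, y) \<in> carrier G"
  shows "(\<Oplus>x\<in>A. \<Oplus>y\<in>B x. f (x, y)) = (\<Oplus>p\<in>Sigma A B. f p)"
proof -
  have eq: "(\<Oplus>y\<in>B x. f (x, y)) = (\<Oplus>p\<in>Pair x ` B x. f p)" if "x \<in> A" for x
    using assms that by (subst finsum_reindex) (auto simp: inj_on_def)
  have "(\<Oplus>x\<in>A. \<Oplus>y\<in>B x. f (x, y)) = (\<Oplus>x\<in>A. \<Oplus>p\<in>Pair x ` B x. f p)"
    using assms by (intro finsum_cong' refl eq) (auto intro!: finsum_closed)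
  also have "\<dots> = (\<Oplus>p\<in>(\<Union>x\<in>A. Pair x ` B x). f p)"
    using assms by (intro add.finprod_UN_disjoint [symmetric]) (auto simp: pairwise_def disjnt_def)
  also have "(\<Union>x\<in>A. Pair x ` B x) = Sigma A B"
    by auto
  finally show ?thesis .
qed

text \<open>Distributivity on both sides, with the order of the factors kept, since the
  multiplication of \<open>T n\<close> is not commutative. Applied to two equal sums it expands the
  square of a Jucys-Murphy element.\<close>

lemma (in semiring) finsum_times_finsum:
  assumes "finite A" "finite B" "f \<in> A \<rightarrow> carrier R" "g \<in> B \<rightarrow> carrier R"
  shows "(\<Oplus>x\<in>A. f x) \<otimes> (\<Oplus>y\<in>B. g y) = (\<Oplus>p\<in>A \<times> B. f (fst p) \<otimes> g (snd p))"
proof -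
  have "(\<Oplus>x\<in>A. f x) \<otimes> (\<Oplus>y\<in>B. g y) = (\<Oplus>x\<in>A. f x \<otimes> (\<Oplus>y\<in>B. g y))"
    using assms by (intro finsum_ldistr) auto
  also have "\<dots> = (\<Oplus>x\<in>A. \<Oplus>y\<in>B. f x \<otimes> g y)"
    using assms by (intro finsum_cong' refl finsum_rdistr) (auto intro!: finsum_closed)
  also have "\<dots> = (\<Oplus>p\<in>A \<times> B. f (fst p) \<otimes> g (snd p))"
    using finsum_Sigma[of A "\<lambda>_. B" "\<lambda>p. f (fst p) \<otimes> g (snd p)"] assms by auto
  finally show ?thesis .
qed

section \<open>Pseudo-transpositions in a ring with the spin relations\<close>

text \<open>The defining relations of the algebra in the form in which they are used: given that the
  generators are involutions, \<open>(t_i t_j)^2 = -1\<close> amounts to anticommutation and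
  \<open>(t_i t_{i+1})^3 = 1\<close> to the braid relation. Stating them over an arbitrary ring
  keeps cosets of polynomials out of the computations.\<close>

locale spin_relations = ring R for R (structure) +
  fixes t :: "nat \<Rightarrow> 'a" and n :: nat
  assumes t_closed [simp]: "\<lbrakk>1 \<le> i; i < n\<rbrakk> \<Longrightarrow> t i \<in> carrier R"
    and t_square: "\<lbrakk>1 \<le> i; i < n\<rbrakk> \<Longrightarrow> t i \<otimes> t i = \<one>"
    and t_anticommute: "\<lbrakk>1 \<le> i; i + 1 < j; j < n\<rbrakk> \<Longrightarrow> t j \<otimes> t i = \<ominus> (t i \<otimes> t j)"
    and t_braid: "\<lbrakk>1 \<le> i; i + 1 < n\<rbrakk> \<Longrightarrow>
      t (i + 1) \<otimes> t i \<otimes> t (i + 1) = t i \<otimes> t (i + 1) \<otimes> t i"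
begin

text \<open>For \<open>j \<le> i\<close> the value is junk.\<close>

primrec transp :: "nat \<Rightarrow> nat \<Rightarrow> 'a" where
  "transp i 0 = \<one>"
| "transp i (Suc j) = (if j \<le> i then t i else \<ominus> (t j \<otimes> transp i j \<otimes> t j))"

lemma t_cancel: "\<lbrakk>1 \<le> i; i < n; x \<in> carrier R\<rbrakk> \<Longrightarrow> t i \<otimes> (t i \<otimes> x) = x"
  by (simp add: t_square flip: m_assoc)

lemma transp_closed [simp]: "\<lbrakk>1 \<le> i; i < j; j \<le> n\<rbrakk> \<Longrightarrow> transp i j \<in> carrier R"
  by (induction j) (auto simp: less_Suc_eq)

text \<open>Up to sign, each recursion step conjugates an involution by an involution; the sign
  disappears in the square.\<close>

lemma transp_square:
  "\<lbrakk>1 \<le> i; i < j; j \<le> n\<rbrakk> \<Longrightarrow> transp i j \<otimes> transp i j = \<one>"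
proof (induction j)
  case (Suc j)
  show ?case
  proof (cases "j = i")
    case False
    with Suc.prems have j: "i < j" "j < n" "1 \<le> j" by auto
    have "transp i j \<otimes> (transp i j \<otimes> t j) = t j"
      using Suc j by (simp flip: m_assoc)
    with Suc.prems j show ?thesis
      by (simp add: m_assoc l_minus r_minus t_cancel t_square)
  qed (use Suc.prems in \<open>simp add: t_square\<close>)
qed simp

text \<open>A parity count: \<open>transp i j\<close> is, up to sign, a word of odd length in
  \<open>t i, ..., t (j - 1)\<close>, and \<open>t k\<close> anticommutes with each of these letters
  because \<open>j < k\<close>. In the induction the two new outer letters contribute signs that
  cancel.\<close>

lemma t_transp_anticommute:
  "\<lbrakk>1 \<le> i; i < j; j < k; k < n\<rbrakk> \<Longrightarrow> t k \<otimes> transp i j = \<ominus> (transp i j \<otimes> t k)"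
proof (induction j)
  case (Suc j)
  show ?case
  proof (cases "j = i")
    case False
    with Suc.prems have j: "1 \<le> i" "i < j" "j < n" "1 \<le> j" "j \<le> n" "1 \<le> k" "k < n" by auto
    note cl = t_closed[OF j(4,3)] t_closed[OF j(6,7)] transp_closed[OF j(1,2,5)]
    have a: "t k \<otimes> t j = \<ominus> (t j \<otimes> t k)"
      using Suc.prems j by (intro t_anticommute) auto
    have b: "t k \<otimes> transp i j = \<ominus> (transp i j \<otimes> t k)"
      using Suc j by simp
    have "t k \<otimes> (t j \<otimes> transp i j \<otimes> t j) = (t k \<otimes> t j) \<otimes> transp i j \<otimes> t j"
      using cl by (simp add: m_assoc)
    also have "\<dots> = \<ominus> (t j \<otimes> (t k \<otimes> transp i j) \<otimes> t j)"
      using cl by (simp add: a m_assoc l_minus)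
    also have "\<dots> = t j \<otimes> transp i j \<otimes> (t k \<otimes> t j)"
      using cl by (simp add: b m_assoc l_minus r_minus)
    also have "\<dots> = \<ominus> (t j \<otimes> transp i j \<otimes> t j \<otimes> t k)"
      using cl by (simp add: a m_assoc r_minus)
    finally show ?thesis
      using j cl by (simp add: l_minus r_minus)
  qed (use Suc.prems t_anticommute in simp)
qed simp

text \<open>The transpositions \<open>(i j)\<close> and \<open>(j j+1)\<close> share exactly one
  index, so they satisfy the braid relation in the symmetric group; the lemma lifts this with the
  correct sign. The induction combines the braid relation of two neighbouring generators, the
  anticommutation of the outer one with \<open>transp i j\<close>, and the induction
  hypothesis.\<close>

lemma transp_braid:
  "\<lbrakk>1 \<le> i; i < j; j < n\<rbrakk> \<Longrightarrow>
    t j \<otimes> transp i j \<otimes> t j = transp i j \<otimes> t j \<otimes> transp i j"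
proof (induction j)
  case (Suc j)
  show ?case
  proof (cases "j = i")
    case False
    with Suc.prems have j: "1 \<le> i" "i < j" "j < n" "1 \<le> j" "j \<le> n" "1 \<le> Suc j" "Suc j < n"
      by auto
    define P s u where "P = transp i j" and "s = t j" and "u = t (Suc j)"
    have cl [simp]: "P \<in> carrier R" "s \<in> carrier R" "u \<in> carrier R"
      using j by (simp_all add: P_def s_def u_def)
    have IH: "s \<otimes> P \<otimes> s = P \<otimes> s \<otimes> P"
      using Suc j by (simp add: P_def s_def)
    have br: "s \<otimes> u \<otimes> s = u \<otimes> s \<otimes> u"
      using t_braid[of j] j by (simp add: s_def u_def)
    have ac: "u \<otimes> P = \<ominus> (P \<otimes> u)"
      using t_transp_anticommute[of i j "Suc j"] j by (simp add: P_def u_def)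
    have uu: "u \<otimes> (u \<otimes> x) = x" if "x \<in> carrier R" for x
      using t_cancel[OF j(6,7) that] by (simp add: u_def)
    \<comment> \<open>The chain starts from the right-hand side of the goal, where the signs of the
      two factors \<open>transp i (Suc j) = \<ominus> (s P s)\<close> cancel. Along the chain
      \<open>u\<close> passes \<open>P\<close> three times; the resulting sign is that of the single
      such factor on the left-hand side.\<close>
    have "s \<otimes> P \<otimes> s \<otimes> u \<otimes> (s \<otimes> P \<otimes> s) = s \<otimes> P \<otimes> (s \<otimes> u \<otimes> s) \<otimes> P \<otimes> s"
      by (simp add: m_assoc)
    also have "\<dots> = s \<otimes> (P \<otimes> u) \<otimes> s \<otimes> (u \<otimes> P) \<otimes> s"
      by (simp add: br m_assoc)
    also have "P \<otimes> u = \<ominus> (u \<otimes> P)"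
      by (simp add: ac)
    also have "s \<otimes> (\<ominus> (u \<otimes> P)) \<otimes> s \<otimes> (u \<otimes> P) \<otimes> s =
        \<ominus> (s \<otimes> u \<otimes> P \<otimes> s \<otimes> (u \<otimes> P) \<otimes> s)"
      by (simp add: m_assoc l_minus r_minus)
    also have "\<dots> = s \<otimes> u \<otimes> (P \<otimes> s \<otimes> P) \<otimes> u \<otimes> s"
      unfolding ac by (simp add: m_assoc l_minus r_minus)
    also have "\<dots> = (s \<otimes> u \<otimes> s) \<otimes> P \<otimes> (s \<otimes> u \<otimes> s)"
      by (simp add: m_assoc flip: IH)
    also have "\<dots> = u \<otimes> s \<otimes> (u \<otimes> P) \<otimes> u \<otimes> s \<otimes> u"
      by (simp add: br m_assoc)
    also have "\<dots> = \<ominus> (u \<otimes> (s \<otimes> P \<otimes> s) \<otimes> u)"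
      by (simp add: ac m_assoc l_minus r_minus uu)
    finally show ?thesis
      using j(2) by (simp add: l_minus r_minus flip: P_def s_def u_def)
  qed (use Suc.prems t_braid in simp)
qed simp

text \<open>In the symmetric group, conjugating \<open>(a b)\<close> by \<open>(a c)\<close> gives
  \<open>(b c)\<close>; here the relation lifts without a sign. Induction on \<open>c\<close>:
  passing to \<open>Suc c\<close> conjugates both sides by \<open>t c\<close>. On the left, the sign
  of \<open>transp a (Suc c)\<close> is compensated by the anticommutation of \<open>t c\<close>
  with \<open>transp a b\<close>; on the right, the signs of the two factors cancel.\<close>

lemma transp_exchange:
  "\<lbrakk>1 \<le> a; a < b; b < c; c \<le> n\<rbrakk> \<Longrightarrow>
    transp a c \<otimes> transp a b = transp b c \<otimes> transp a c"
proof (induction c)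
  case (Suc c)
  show ?case
  proof (cases "c = b")
    case True
    with Suc.prems have b: "1 \<le> a" "a < b" "b < n" "1 \<le> b" "b \<le> n" by auto
    \<comment> \<open>The upper index is now \<open>Suc b\<close>, so
      \<open>transp b (Suc b)\<close> is just \<open>t b\<close>. The braid relation makes
      \<open>transp a b\<close> appear twice in a row at the right end, where it cancels.\<close>
    have "t b \<otimes> transp a b \<otimes> t b \<otimes> transp a b = transp a b \<otimes> t b"
      unfolding transp_braid[OF b(1-3)] using b by (simp add: m_assoc transp_square)
    with b True show ?thesis
      by (simp add: l_minus r_minus m_assoc t_cancel)
  next
    case False
    with Suc.prems have c: "1 \<le> a" "a < b" "b < c" "c < n" "1 \<le> c" "c \<le> n" "1 \<le> b" "a < c" "b \<le> n"
      by auto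
    have ac: "transp a b \<otimes> t c = \<ominus> (t c \<otimes> transp a b)"
      using t_transp_anticommute[of a b c] c by simp
    have "t c \<otimes> transp a c \<otimes> t c \<otimes> transp a b = \<ominus> (t c \<otimes> (transp a c \<otimes> transp a b) \<otimes> t c)"
      using c by (simp add: m_assoc ac r_minus)
    also have "transp a c \<otimes> transp a b = transp b c \<otimes> transp a c"
      using Suc c by simp
    also have "t c \<otimes> (transp b c \<otimes> transp a c) \<otimes> t c =
        (t c \<otimes> transp b c \<otimes> t c) \<otimes> (t c \<otimes> transp a c \<otimes> t c)"
      using c by (simp add: m_assoc t_cancel)
    finally show ?thesis
      using c by (simp add: l_minus r_minus)
  qed
qed simp

end

section \<open>Cosets, and the spin relations for the generators of \<open>T n\<close>\<close>

lemma coset_closed: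
  "p \<in> carrier (free_algebra {1..<n}) \<Longrightarrow> coset n p \<in> carrier (T n)"
  using ring_hom_closed[OF coset_hom] by (simp add: T_simps)

lemma coset_add:
  assumes "p \<in> carrier (free_algebra {1..<n})" "q \<in> carrier (free_algebra {1..<n})"
  shows "coset n p \<oplus>\<^bsub>T n\<^esub> coset n q = coset n (p + q)"
  using ring_hom_add[OF coset_hom assms] by (simp add: T_simps free_algebra_def)

lemma coset_zero: "coset n 0 = \<zero>\<^bsub>T n\<^esub>"
  using ring_hom_zero[OF coset_hom ring_free_algebra ring_T_ring, of n]
  by (simp add: T_simps free_algebra_def)

lemma uminus_in_free_algebra:
  "p \<in> carrier (free_algebra G) \<Longrightarrow> - p \<in> carrier (free_algebra G)"
  by (simp add: free_algebra_def)

lemma coset_uminus: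
  assumes "p \<in> carrier (free_algebra {1..<n})"
  shows "coset n (- p) = \<ominus>\<^bsub>T n\<^esub> coset n p"
proof -
  interpret T: ring "T n" by (rule ring_T)
  have m: "- p \<in> carrier (free_algebra {1..<n})"
    using assms by (rule uminus_in_free_algebra)
  have "coset n (- p) \<oplus>\<^bsub>T n\<^esub> coset n p = \<zero>\<^bsub>T n\<^esub>"
    using coset_add[OF m assms] by (simp add: coset_zero)
  then show ?thesis
    using T.minus_equality coset_closed[OF assms] coset_closed[OF m] by metis
qed

lemma coset_relator:
  assumes "p - q \<in> relators n"
    and "p \<in> carrier (free_algebra {1..<n})" "q \<in> carrier (free_algebra {1..<n})"
  shows "coset n p = coset n q"
  using assms ring.genideal_self[OF ring_free_algebra relators_subset]
  by (auto simp: coset_eq_iff rel_ideal_def)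

lemma mult_in_free_algebra:
  assumes "p \<in> carrier (free_algebra G)" "q \<in> carrier (free_algebra G)"
  shows "p * q \<in> carrier (free_algebra G)"
  using monoid.m_closed[OF ring.axioms(2)[OF ring_free_algebra] assms]
  by (simp add: free_algebra_def)

lemma one_in_free_algebra: "1 \<in> carrier (free_algebra G)"
  by (simp add: free_algebra_def zero_free_monoid_def)

lemma tau_anticommute:
  assumes "1 \<le> i" "i + 1 < j" "j < n"
  shows "tau n j \<otimes>\<^bsub>T n\<^esub> tau n i = \<ominus>\<^bsub>T n\<^esub> (tau n i \<otimes>\<^bsub>T n\<^esub> tau n j)"
proof -
  interpret T: ring "T n" by (rule ring_T)
  define g h :: free_poly where "g = gen_var i" and "h = gen_var j"
  define X Y where "X = tau n i" and "Y = tau n j"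
  have gh: "g \<in> carrier (free_algebra {1..<n})" "h \<in> carrier (free_algebra {1..<n})"
    using assms by (auto simp: g_def h_def intro!: gen_var_in_carrier)
  note cl = gh mult_in_free_algebra[OF gh]
  have X: "X \<in> carrier (T n)" "X \<otimes>\<^bsub>T n\<^esub> X = \<one>\<^bsub>T n\<^esub>"
    and Y: "Y \<in> carrier (T n)" "Y \<otimes>\<^bsub>T n\<^esub> Y = \<one>\<^bsub>T n\<^esub>"
    using assms by (auto simp: X_def Y_def intro!: tau_closed tau_square)
  have "1 \<le> i \<and> i < n \<and> 1 \<le> j \<and> j < n \<and> \<bar>int i - int j\<bar> > 1"
    using assms by auto
  then have "(g * h) * (g * h) + 1 \<in> relators n"
    unfolding relators_def g_def h_def power2_eq_square by blast
  then have "(g * h) * (g * h) - (- 1) \<in> relators n"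
    by simp
  then have "coset n ((g * h) * (g * h)) = coset n (- 1)"
    by (intro coset_relator mult_in_free_algebra uminus_in_free_algebra one_in_free_algebra gh)
  also have "\<dots> = \<ominus>\<^bsub>T n\<^esub> \<one>\<^bsub>T n\<^esub>"
    by (simp add: coset_uminus one_in_free_algebra coset_one)
  finally have *: "(X \<otimes>\<^bsub>T n\<^esub> Y) \<otimes>\<^bsub>T n\<^esub> (X \<otimes>\<^bsub>T n\<^esub> Y) = \<ominus>\<^bsub>T n\<^esub> \<one>\<^bsub>T n\<^esub>"
    by (simp add: X_def Y_def tau_def coset_mult cl del: One_nat_def flip: g_def h_def)
  \<comment> \<open>The squares inserted on both sides are units; regrouped, they complete
    \<open>Y X\<close> to \<open>X (X Y)^2 Y\<close>.\<close>
  have "Y \<otimes>\<^bsub>T n\<^esub> X = (X \<otimes>\<^bsub>T n\<^esub> X) \<otimes>\<^bsub>T n\<^esub> (Y \<otimes>\<^bsub>T n\<^esub> X) \<otimes>\<^bsub>T n\<^esub> (Y \<otimes>\<^bsub>T n\<^esub> Y)"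
    using X Y by simp
  also have "\<dots> = X \<otimes>\<^bsub>T n\<^esub> ((X \<otimes>\<^bsub>T n\<^esub> Y) \<otimes>\<^bsub>T n\<^esub> (X \<otimes>\<^bsub>T n\<^esub> Y)) \<otimes>\<^bsub>T n\<^esub> Y"
    using X(1) Y(1) by (simp add: T.m_assoc)
  also have "\<dots> = \<ominus>\<^bsub>T n\<^esub> (X \<otimes>\<^bsub>T n\<^esub> Y)"
    unfolding * using X(1) Y(1) by (simp add: T.l_minus T.r_minus)
  finally show ?thesis by (simp add: X_def Y_def)
qed

lemma tau_braid:
  assumes "1 \<le> i" "i + 1 < n"
  shows "tau n (i + 1) \<otimes>\<^bsub>T n\<^esub> tau n i \<otimes>\<^bsub>T n\<^esub> tau n (i + 1) =
    tau n i \<otimes>\<^bsub>T n\<^esub> tau n (i + 1) \<otimes>\<^bsub>T n\<^esub> tau n i"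
proof -
  interpret T: ring "T n" by (rule ring_T)
  define g h :: free_poly where "g = gen_var i" and "h = gen_var (i + 1)"
  define X Y where "X = tau n i" and "Y = tau n (i + 1)"
  have gh: "g \<in> carrier (free_algebra {1..<n})" "h \<in> carrier (free_algebra {1..<n})"
    using assms by (auto simp: g_def h_def intro!: gen_var_in_carrier)
  note cl = gh mult_in_free_algebra[OF gh]
    mult_in_free_algebra[OF mult_in_free_algebra[OF gh] mult_in_free_algebra[OF gh]]
  have X: "X \<in> carrier (T n)" "X \<otimes>\<^bsub>T n\<^esub> X = \<one>\<^bsub>T n\<^esub>"
    and Y: "Y \<in> carrier (T n)" "Y \<otimes>\<^bsub>T n\<^esub> Y = \<one>\<^bsub>T n\<^esub>"
    using assms by (auto simp: X_def Y_def simp del: One_nat_def intro!: tau_closed tau_square)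
  have "(g * h) * (g * h) * (g * h) - 1 \<in> relators n"
    using assms unfolding relators_def g_def h_def power3_eq_cube by blast
  then have "coset n ((g * h) * (g * h) * (g * h)) = coset n 1"
    by (intro coset_relator mult_in_free_algebra one_in_free_algebra gh)
  moreover have "X = coset n g" "Y = coset n h"
    by (simp_all only: X_def Y_def g_def h_def tau_def)
  ultimately have *: "(X \<otimes>\<^bsub>T n\<^esub> Y) \<otimes>\<^bsub>T n\<^esub> (X \<otimes>\<^bsub>T n\<^esub> Y) \<otimes>\<^bsub>T n\<^esub> (X \<otimes>\<^bsub>T n\<^esub> Y) = \<one>\<^bsub>T n\<^esub>"
    by (simp add: coset_mult cl coset_one del: One_nat_def)
  have XX: "X \<otimes>\<^bsub>T n\<^esub> (X \<otimes>\<^bsub>T n\<^esub> Z) = Z" and YY: "Y \<otimes>\<^bsub>T n\<^esub> (Y \<otimes>\<^bsub>T n\<^esub> Z) = Z"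
    if "Z \<in> carrier (T n)" for Z
    using X Y that by (simp_all flip: T.m_assoc)
  \<comment> \<open>The unit inserted here is replaced by \<open>(X Y)^3\<close> in the next step;
    cancelling adjacent equal letters then leaves \<open>Y X Y\<close>.\<close>
  have "X \<otimes>\<^bsub>T n\<^esub> Y \<otimes>\<^bsub>T n\<^esub> X = X \<otimes>\<^bsub>T n\<^esub> \<one>\<^bsub>T n\<^esub> \<otimes>\<^bsub>T n\<^esub> Y \<otimes>\<^bsub>T n\<^esub> X"
    using X Y by simp
  also have "\<dots> = Y \<otimes>\<^bsub>T n\<^esub> X \<otimes>\<^bsub>T n\<^esub> Y"
    unfolding * [symmetric] using X Y by (simp add: T.m_assoc XX YY)
  finally show ?thesis by (simp add: X_def Y_def)
qed

lemma spin_relations_tau: "spin_relations (T n) (tau n) n"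
  by (intro spin_relations.intro spin_relations_axioms.intro ring_T tau_closed tau_square
      tau_anticommute tau_braid)

section \<open>Scalars, acting as left multiplication by cosets of constants\<close>

lemma smult_closed: "X \<in> carrier (T n) \<Longrightarrow> c \<odot>\<^bsub>T n\<^esub> X \<in> carrier (T n)"
  using monoid.m_closed[OF ring.axioms(2)[OF ring_T] coset_closed[OF const_in_carrier]]
  by (simp add: T_simps)

lemma smult_smult:
  assumes "X \<in> carrier (T n)"
  shows "c \<odot>\<^bsub>T n\<^esub> (d \<odot>\<^bsub>T n\<^esub> X) = (c * d) \<odot>\<^bsub>T n\<^esub> X"
proof -
  interpret T: ring "T n" by (rule ring_T)
  have "const c * const d = const (c * d)"
    by (simp add: const_def mult_single)
  then show ?thesis
    using coset_mult[OF const_in_carrier const_in_carrier, of n c d]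
      T.m_assoc[OF coset_closed[OF const_in_carrier] coset_closed[OF const_in_carrier] assms, of c d]
    by (simp add: T_simps)
qed

lemma smult_uminus:
  assumes "X \<in> carrier (T n)"
  shows "(- c) \<odot>\<^bsub>T n\<^esub> X = \<ominus>\<^bsub>T n\<^esub> (c \<odot>\<^bsub>T n\<^esub> X)"
proof -
  interpret T: ring "T n" by (rule ring_T)
  have "const (- c) = - const c"
    by (simp add: const_def single_uminus)
  then show ?thesis
    using T.l_minus[OF coset_closed[OF const_in_carrier] assms, of c]
      coset_uminus[OF const_in_carrier, of n c]
    by (simp add: T_simps)
qed

lemma smult_one:
  assumes "X \<in> carrier (T n)"
  shows "1 \<odot>\<^bsub>T n\<^esub> X = X"
proof -
  interpret T: ring "T n" by (rule ring_T)
  have "const 1 = 1"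
    by (simp add: const_def)
  then show ?thesis
    using T.l_one[OF assms] coset_one[of n] by (simp add: T_simps)
qed

lemma smult_finsum:
  assumes "finite A" "f \<in> A \<rightarrow> carrier (T n)"
  shows "c \<odot>\<^bsub>T n\<^esub> (\<Oplus>\<^bsub>T n\<^esub>x\<in>A. f x) = (\<Oplus>\<^bsub>T n\<^esub>x\<in>A. c \<odot>\<^bsub>T n\<^esub> f x)"
proof -
  interpret T: ring "T n" by (rule ring_T)
  have "c \<odot>\<^bsub>T n\<^esub> X = coset n (const c) \<otimes>\<^bsub>T n\<^esub> X" for X
    by (simp add: T_simps)
  then show ?thesis
    using T.finsum_rdistr[OF assms(1) coset_closed[OF const_in_carrier] assms(2)] by simp
qed

section \<open>Words in the generators and pseudo-transpositions\<close>

lemma list_prod_closed: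
  assumes "set xs \<subseteq> carrier (T n)"
  shows "list_prod n xs \<in> carrier (T n)"
proof -
  interpret T: ring "T n" by (rule ring_T)
  show ?thesis using assms by (induction xs) (auto simp: list_prod_def)
qed

lemma list_prod_snoc:
  assumes "set xs \<subseteq> carrier (T n)" "y \<in> carrier (T n)"
  shows "list_prod n (xs @ [y]) = list_prod n xs \<otimes>\<^bsub>T n\<^esub> y"
proof -
  interpret T: ring "T n" by (rule ring_T)
  have "foldr (\<lambda>x y. x \<otimes>\<^bsub>T n\<^esub> y) xs \<one>\<^bsub>T n\<^esub> \<in> carrier (T n)"
    if "set xs \<subseteq> carrier (T n)" for xs
    using list_prod_closed[OF that] by (simp add: list_prod_def)
  then show ?thesis
    using assms by (induction xs) (auto simp: list_prod_def T.m_assoc)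
qed

text \<open>The word for \<open>(i, Suc j)\<close> is the word for \<open>(i, j)\<close> with the
  letter \<open>tau n j\<close> added at both ends, and the exponent of the sign grows by one. This
  is the recursion of \<open>transp\<close>; it starts at \<open>j = Suc i\<close> with the single
  letter \<open>tau n i\<close> and exponent 0.\<close>

lemma pseudo_transposition_eq_transp:
  "\<lbrakk>1 \<le> i; i < j; j \<le> n\<rbrakk> \<Longrightarrow>
    pseudo_transposition n i j = spin_relations.transp (T n) (tau n) i j"
proof (induction j)
  case (Suc j)
  interpret spin_relations "T n" "tau n" n by (rule spin_relations_tau)
  show ?case
  proof (cases "j = i")
    case True
    have "tau n i \<in> carrier (T n)"
      using Suc.prems True by (intro tau_closed) auto
    then show ?thesis
      using True by (simp add: pseudo_transposition_def list_prod_def smult_one)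
  next
    case False
    with Suc.prems have j: "i < j" "j < n" "1 \<le> j" by auto
    let ?L = "map (tau n) (rev [i..<j] @ [i + 1..<j])"
    have L: "set ?L \<subseteq> carrier (T n)" and tj: "tau n j \<in> carrier (T n)"
      using Suc.prems j by (auto intro!: tau_closed simp del: One_nat_def)
    have eq: "map (tau n) (rev [i..<Suc j] @ [i + 1..<Suc j]) = tau n j # (?L @ [tau n j])"
      using j by simp
    have "list_prod n (tau n j # (?L @ [tau n j])) =
        tau n j \<otimes>\<^bsub>T n\<^esub> list_prod n (?L @ [tau n j])"
      by (simp add: list_prod_def)
    then have prod: "list_prod n (map (tau n) (rev [i..<Suc j] @ [i + 1..<Suc j])) =
        tau n j \<otimes>\<^bsub>T n\<^esub> list_prod n ?L \<otimes>\<^bsub>T n\<^esub> tau n j"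
      unfolding eq list_prod_snoc[OF L tj]
      using list_prod_closed[OF L] tj by (simp add: m_assoc)
    have sign: "(-1) ^ k \<odot>\<^bsub>T n\<^esub> X = (if even k then X else \<ominus>\<^bsub>T n\<^esub> X)"
      if "X \<in> carrier (T n)" for k X
      using that by (simp add: smult_one smult_uminus)
    have IH: "transp i j = pseudo_transposition n i j"
      using Suc.IH Suc.prems j by simp
    have "Suc j - i - 1 = Suc (j - i - 1)"
      using j by simp
    then have "pseudo_transposition n i (Suc j) =
        \<ominus>\<^bsub>T n\<^esub> (tau n j \<otimes>\<^bsub>T n\<^esub> pseudo_transposition n i j \<otimes>\<^bsub>T n\<^esub> tau n j)"
      unfolding pseudo_transposition_def prod
      using list_prod_closed[OF L] tj
      by (simp only: sign m_closed) (simp add: l_minus r_minus del: map_append)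
    then show ?thesis
      using j by (simp add: IH)
  qed
qed simp

section \<open>Roots and reflections in terms of indices\<close>

lemma orthonormal_basis_scalar_prod_diff:
  assumes "orthonormal_basis n \<xi>" "i \<in> {1..n}" "j \<in> {1..n}" "k \<in> {1..n}"
  shows "(\<xi> i - \<xi> j) \<bullet> \<xi> k = (if i = k then 1 else 0) - (if j = k then 1 else 0)"
proof -
  have "\<xi> m \<in> carrier_vec n" if "m \<in> {1..n}" for m
    using assms(1) that by (auto simp: orthonormal_basis_def)
  then show ?thesis
    using assms by (subst minus_scalar_prod_distrib[of _ n]) (auto simp: orthonormal_basis_def)
qed

lemma orthonormal_basis_scalar_prod_diff_diff:
  assumes "orthonormal_basis n \<xi>" "i \<in> {1..n}" "j \<in> {1..n}" "k \<in> {1..n}" "l \<in> {1..n}"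
  shows "(\<xi> i - \<xi> j) \<bullet> (\<xi> k - \<xi> l) =
    (if i = k then 1 else 0) - (if j = k then 1 else 0)
    - (if i = l then 1 else 0) + (if j = l then 1 else 0)"
proof -
  have "\<xi> m \<in> carrier_vec n" if "m \<in> {1..n}" for m
    using assms(1) that by (auto simp: orthonormal_basis_def)
  then show ?thesis
    using assms
    by (subst scalar_prod_minus_distrib[of _ n])
       (auto simp: orthonormal_basis_scalar_prod_diff[OF assms(1)])
qed

lemma diff_in_pos_roots_iff:
  assumes on: "orthonormal_basis n \<xi>" and ab: "a \<in> {1..n}" "b \<in> {1..n}" "a \<noteq> b"
  shows "\<xi> a - \<xi> b \<in> pos_roots n \<xi> \<longleftrightarrow> a < b"
proof
  assume "\<xi> a - \<xi> b \<in> pos_roots n \<xi>"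
  then obtain i j where ij: "1 \<le> i" "i < j" "j \<le> n" and eq: "\<xi> a - \<xi> b = \<xi> i - \<xi> j"
    unfolding pos_roots_def by blast
  have "i \<in> {1..n}" "j \<in> {1..n}"
    using ij by auto
  note ip = orthonormal_basis_scalar_prod_diff[OF on]
  \<comment> \<open>Pairing a root with the basis vectors recovers its indices: the value is 1 only
    at the first index and -1 only at the second.\<close>
  have "(\<xi> i - \<xi> j) \<bullet> \<xi> a = 1" "(\<xi> i - \<xi> j) \<bullet> \<xi> b = - 1"
    using ip[of a b a] ip[of a b b] ab by (auto simp: eq)
  then have "i = a" "j = b"
    using ip[of i j a] ip[of i j b] ab \<open>i \<in> _\<close> \<open>j \<in> _\<close> by (auto split: if_splits)
  with ij show "a < b" by simp
next
  assume "a < b"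
  with ab show "\<xi> a - \<xi> b \<in> pos_roots n \<xi>"
    unfolding pos_roots_def by auto
qed

text \<open>The reflection in \<open>\<xi> i - \<xi> j\<close> swaps \<open>\<xi> i\<close> with
  \<open>\<xi> j\<close> and fixes the other basis vectors; the minus sign exchanges the two terms.
  Once the scalar products are known, a componentwise check over the coincidences among the four
  indices remains.\<close>

lemma uminus_reflection_diff:
  assumes on: "orthonormal_basis n \<xi>"
    and ij: "i \<in> {1..n}" "j \<in> {1..n}" "i \<noteq> j" and kl: "k \<in> {1..n}" "l \<in> {1..n}" "k \<noteq> l"
  shows "- reflection (\<xi> i - \<xi> j) (\<xi> k - \<xi> l) =
    \<xi> (Transposition.transpose i j l) - \<xi> (Transposition.transpose i j k)"
proof -
  have car: "\<xi> m \<in> carrier_vec n" if "m \<in> {1..n}" for m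
    using on that by (auto simp: orthonormal_basis_def)
  have dim: "dim_vec (\<xi> i) = n" "dim_vec (\<xi> j) = n" "dim_vec (\<xi> k) = n" "dim_vec (\<xi> l) = n"
    using car ij kl by (meson carrier_vecD)+
  show ?thesis
    unfolding reflection_def
      orthonormal_basis_scalar_prod_diff_diff[OF on kl(1,2) ij(1,2)]
      orthonormal_basis_scalar_prod_diff_diff[OF on ij(1,2) ij(1,2)]
    using ij kl by (intro eq_vecI) (auto simp: dim Transposition.transpose_def)
qed

section \<open>Jucys-Murphy elements and the Casimir element as sums over indices\<close>

lemma pos_roots_eq_image:
  "pos_roots n \<xi> = (\<lambda>(i, j). \<xi> i - \<xi> j) ` {(i, j). 1 \<le> i \<and> i < j \<and> j \<le> n}"
  unfolding pos_roots_def by auto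

text \<open>A positive root \<open>\<xi> i - \<xi> j\<close> has negative product with
  \<open>\<xi> k\<close> exactly when \<open>j = k\<close>, and distinct \<open>i\<close> give
  distinct roots.\<close>

lemma jucys_murphy_eq:
  assumes on: "orthonormal_basis n \<xi>" and k: "k \<in> {1..n}"
  shows "jucys_murphy n \<xi> k =
    (\<Oplus>\<^bsub>T n\<^esub>i\<in>{1..<k}. spin_relations.transp (T n) (tau n) i k)"
proof -
  interpret spin_relations "T n" "tau n" n by (rule spin_relations_tau)
  have set: "{\<alpha> \<in> pos_roots n \<xi>. \<alpha> \<bullet> \<xi> k < 0} = (\<lambda>i. \<xi> i - \<xi> k) ` {1..<k}"
    (is "?L = ?R")
  proof
    show "?L \<subseteq> ?R"
      using k by (auto simp: pos_roots_def orthonormal_basis_scalar_prod_diff[OF on] split: if_splits)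
    show "?R \<subseteq> ?L"
      using k by (auto simp: diff_in_pos_roots_iff[OF on] orthonormal_basis_scalar_prod_diff[OF on])
  qed
  have inj: "inj_on (\<lambda>i. \<xi> i - \<xi> k) {1..<k}"
    using orthonormal_basis_diff_eqD[OF on] k by (fastforce intro!: inj_onI)
  have tr: "tau_root n \<xi> (\<xi> i - \<xi> k) = transp i k" if "i \<in> {1..<k}" for i
    using that k by (simp add: tau_root_eq[OF on] pseudo_transposition_eq_transp)
  have "finsum (T n) (tau_root n \<xi>) ((\<lambda>i. \<xi> i - \<xi> k) ` {1..<k}) =
      (\<Oplus>\<^bsub>T n\<^esub>i\<in>{1..<k}. tau_root n \<xi> (\<xi> i - \<xi> k))"
    using tr k by (intro finsum_reindex[OF _ inj]) auto
  also have "\<dots> = (\<Oplus>\<^bsub>T n\<^esub>i\<in>{1..<k}. transp i k)"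
    using tr k by (intro finsum_cong' refl) auto
  finally show ?thesis
    unfolding jucys_murphy_def set .
qed

definition ordered_pairs :: "nat \<Rightarrow> (nat \<times> nat) set" where
  "ordered_pairs n = {(i, j). 1 \<le> i \<and> i < j \<and> j \<le> n}"

text \<open>The condition that the reflection in \<alpha> makes \<beta> negative, read off on
  indices for \<alpha> = \<open>\<xi> i - \<xi> j\<close> and \<beta> =
  \<open>\<xi> k - \<xi> l\<close>: the transposition of \<open>i\<close> and \<open>j\<close>
  reverses the order of \<open>k\<close> and \<open>l\<close>.\<close>

definition inversion_pairs :: "nat \<Rightarrow> ((nat \<times> nat) \<times> nat \<times> nat) set" where
  "inversion_pairs n = {((i, j), (k, l)). (i, j) \<in> ordered_pairs n \<and> (k, l) \<in> ordered_pairs n \<and>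
     Transposition.transpose i j l < Transposition.transpose i j k}"

lemma finite_inversion_pairs: "finite (inversion_pairs n)"
  by (rule finite_subset[of _ "({1..n} \<times> {1..n}) \<times> ({1..n} \<times> {1..n})"])
     (auto simp: inversion_pairs_def ordered_pairs_def)

text \<open>All roots have length \<open>sqrt 2\<close>, so every summand carries the weight 2,
  which turns the factor 1/4 into 1/2. The rest is a change of index from pairs of roots to pairs of
  index pairs.\<close>

lemma casimir_eq:
  assumes on: "orthonormal_basis n \<xi>"
  shows "casimir n \<xi> = (1 / 2) \<odot>\<^bsub>T n\<^esub> (\<Oplus>\<^bsub>T n\<^esub>p\<in>inversion_pairs n. case p of ((i, j), (k, l)) \<Rightarrow>
      spin_relations.transp (T n) (tau n) i j \<otimes>\<^bsub>T n\<^esub> spin_relations.transp (T n) (tau n) k l)"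
proof -
  interpret spin_relations "T n" "tau n" n by (rule spin_relations_tau)
  define r where "r = (\<lambda>(i, j). \<xi> i - \<xi> j)"
  define f where "f = (\<lambda>((i, j), (k, l)). transp i j \<otimes>\<^bsub>T n\<^esub> transp k l)"
  have refl: "- reflection (r p) (r q) \<in> pos_roots n \<xi> \<longleftrightarrow> (p, q) \<in> inversion_pairs n"
    if "p \<in> ordered_pairs n" "q \<in> ordered_pairs n" for p q
  proof -
    obtain i j k l where p: "p = (i, j)" and q: "q = (k, l)"
      by (metis surj_pair)
    have ij: "i \<in> {1..n}" "j \<in> {1..n}" "i \<noteq> j" and kl: "k \<in> {1..n}" "l \<in> {1..n}" "k \<noteq> l"
      using that by (auto simp: p q ordered_pairs_def)
    have "Transposition.transpose i j m \<in> {1..n}" if "m \<in> {1..n}" for m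
      using ij that by (simp add: Transposition.transpose_def)
    moreover have "Transposition.transpose i j l \<noteq> Transposition.transpose i j k"
      using kl(3) by (auto dest: transpose_eq_imp_eq)
    ultimately show ?thesis
      using that kl(1,2)
      by (simp add: p q r_def uminus_reflection_diff[OF on ij kl] diff_in_pos_roots_iff[OF on]
          inversion_pairs_def)
  qed
  have inj: "inj_on r (ordered_pairs n)"
    using orthonormal_basis_diff_eqD[OF on]
    by (auto intro!: inj_onI simp: r_def ordered_pairs_def)
  have sub: "inversion_pairs n \<subseteq> ordered_pairs n \<times> ordered_pairs n"
    by (auto simp: inversion_pairs_def)
  \<comment> \<open>Injectivity ensures that each pair of roots is counted once after the change of
    index.\<close>
  have inj2: "inj_on (map_prod r r) (inversion_pairs n)"
    using inj_on_subset[OF map_prod_inj_on[OF inj inj] sub] .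
  have pos: "pos_roots n \<xi> = r ` ordered_pairs n"
    by (simp add: pos_roots_eq_image r_def ordered_pairs_def)
  have set: "{(\<alpha>, \<beta>). \<alpha> \<in> pos_roots n \<xi> \<and> \<beta> \<in> pos_roots n \<xi> \<and>
      - reflection \<alpha> \<beta> \<in> pos_roots n \<xi>} = map_prod r r ` inversion_pairs n"
    (is "?L = ?R")
  proof
    show "?L \<subseteq> ?R"
    proof
      fix x assume "x \<in> ?L"
      then obtain p q where pq: "x = (r p, r q)" "p \<in> ordered_pairs n" "q \<in> ordered_pairs n"
        and "- reflection (r p) (r q) \<in> pos_roots n \<xi>"
        by (auto simp: pos)
      then have "(p, q) \<in> inversion_pairs n"
        using refl by blast
      then show "x \<in> ?R"
        using pq by force
    qed
    show "?R \<subseteq> ?L"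
      using sub refl by (auto simp: pos)
  qed
  have fcl: "f \<in> inversion_pairs n \<rightarrow> carrier (T n)"
    by (auto simp: f_def inversion_pairs_def ordered_pairs_def)
  have len: "root_length (r p) = sqrt 2" if "p \<in> ordered_pairs n" for p
    using that
    by (auto simp: r_def root_length_def ordered_pairs_def
        orthonormal_basis_scalar_prod_diff_diff[OF on])
  have tr: "tau_root n \<xi> (r (i, j)) = transp i j" if "(i, j) \<in> ordered_pairs n" for i j
    using that tau_root_eq[OF on] pseudo_transposition_eq_transp
    by (auto simp: r_def ordered_pairs_def)
  let ?g = "\<lambda>p. complex_of_real (root_length (fst p) * root_length (snd p)) \<odot>\<^bsub>T n\<^esub>
            (tau_root n \<xi> (fst p) \<otimes>\<^bsub>T n\<^esub> tau_root n \<xi> (snd p))"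
  have g: "?g (map_prod r r x) = 2 \<odot>\<^bsub>T n\<^esub> f x" if "x \<in> inversion_pairs n" for x
    using that sub by (auto simp: f_def len tr simp flip: of_real_mult)
  have gcl: "2 \<odot>\<^bsub>T n\<^esub> f x \<in> carrier (T n)" if "x \<in> inversion_pairs n" for x
    using fcl that by (intro smult_closed) auto
  have "(\<Oplus>\<^bsub>T n\<^esub>p\<in>map_prod r r ` inversion_pairs n. ?g p) =
      (\<Oplus>\<^bsub>T n\<^esub>x\<in>inversion_pairs n. ?g (map_prod r r x))"
    by (intro finsum_reindex[OF _ inj2] Pi_I) (elim imageE, simp only: g gcl)
  also have "\<dots> = (\<Oplus>\<^bsub>T n\<^esub>x\<in>inversion_pairs n. 2 \<odot>\<^bsub>T n\<^esub> f x)"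
    using g gcl by (intro finsum_cong' refl) blast+
  also have "\<dots> = 2 \<odot>\<^bsub>T n\<^esub> (\<Oplus>\<^bsub>T n\<^esub>x\<in>inversion_pairs n. f x)"
    using smult_finsum[OF finite_inversion_pairs fcl] by simp
  finally have "casimir n \<xi> = (1 / 4) \<odot>\<^bsub>T n\<^esub> (2 \<odot>\<^bsub>T n\<^esub> (\<Oplus>\<^bsub>T n\<^esub>x\<in>inversion_pairs n. f x))"
    unfolding casimir_def set by (rule arg_cong)
  also have "\<dots> = (1 / 2) \<odot>\<^bsub>T n\<^esub> (\<Oplus>\<^bsub>T n\<^esub>x\<in>inversion_pairs n. f x)"
    using smult_smult[OF finsum_closed[OF fcl], of "1 / 4" 2] by simp
  finally show ?thesis
    by (simp add: f_def case_prod_unfold)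
qed

section \<open>Matching inversion pairs with the terms of the squares\<close>

text \<open>Swapping \<open>i < j\<close> can reverse \<open>k < l\<close> only if the two pairs
  start or end at the same index and \<open>k\<close>, \<open>l\<close> lie between \<open>i\<close>
  and \<open>j\<close>. The diagonal case of two equal roots falls under the first alternative, with
  \<open>l = j\<close>.\<close>

lemma inversion_pairs_iff:
  "((i, j), (k, l)) \<in> inversion_pairs n \<longleftrightarrow>
    1 \<le> i \<and> i < j \<and> j \<le> n \<and> (k = i \<and> i < l \<and> l \<le> j \<or> l = j \<and> i < k \<and> k < j)"
  by (auto simp: inversion_pairs_def ordered_pairs_def Transposition.transpose_def split: if_splits)

text \<open>The first case of the bijection is the substitution of \<open>transp_exchange\<close>.\<close>

lemma bij_betw_inversion_pairs:
  "bij_betw (\<lambda>((i, j), (k, l)). if k = i \<and> l < j then (j, l, i) else (j, i, k))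
    (inversion_pairs n) (Sigma {1..n} (\<lambda>k. {1..<k} \<times> {1..<k}))"
  \<comment> \<open>The order of the last two entries of a triple tells which case produced it: the
    first case gives \<open>(j, l, i)\<close> with \<open>i < l\<close>, the second
    \<open>(j, i, k)\<close> with \<open>i \<le> k\<close>.\<close>
  by (rule bij_betw_byWitness[where
        f' = "\<lambda>(k, i, j). if j < i then ((j, k), (j, i)) else ((i, k), (j, k))"])
     (auto simp: inversion_pairs_iff split: if_splits)

theorem lemma5p12:
  fixes n :: nat and \<xi> :: "nat \<Rightarrow> real vec"
  assumes "n \<ge> 1"
    and "orthonormal_basis n \<xi>"
  shows "casimir n \<xi> =
           (1 / 2) \<odot>\<^bsub>T n\<^esub> (\<Oplus>\<^bsub>T n\<^esub> k \<in> {1..n}. jucys_murphy n \<xi> k [^]\<^bsub>T n\<^esub> (2::nat))"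
proof -
  interpret spin_relations "T n" "tau n" n by (rule spin_relations_tau)
  note on = assms(2)
  define h :: "(nat \<times> nat) \<times> nat \<times> nat \<Rightarrow> nat \<times> nat \<times> nat"
    where "h = (\<lambda>((i, j), (k, l)). if k = i \<and> l < j then (j, l, i) else (j, i, k))"
  let ?S = "Sigma {1..n} (\<lambda>k. {1..<k} \<times> {1..<k})"
  \<comment> \<open>\<open>F (k, i, j)\<close> is the term with indices \<open>i\<close> and
    \<open>j\<close> in the expansion of the square of the \<open>k\<close>-th Jucys-Murphy
    element.\<close>
  define F where "F = (\<lambda>(k, i, j). transp i k \<otimes>\<^bsub>T n\<^esub> transp j k)"
  have h: "inj_on h (inversion_pairs n)" "h ` inversion_pairs n = ?S"
    using bij_betw_inversion_pairs[of n] unfolding h_def by (auto simp only: bij_betw_def)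
  have Fcl: "F (k, p) \<in> carrier (T n)" if "k \<in> {1..n}" "p \<in> {1..<k} \<times> {1..<k}" for k p
    using that by (auto simp: F_def)
  have "jucys_murphy n \<xi> k [^]\<^bsub>T n\<^esub> (2::nat) = (\<Oplus>\<^bsub>T n\<^esub>p\<in>{1..<k} \<times> {1..<k}. F (k, p))"
    if k: "k \<in> {1..n}" for k
  proof -
    have cl: "(\<lambda>i. transp i k) \<in> {1..<k} \<rightarrow> carrier (T n)"
      using k by auto
    have "jucys_murphy n \<xi> k [^]\<^bsub>T n\<^esub> (2::nat) =
        (\<Oplus>\<^bsub>T n\<^esub>i\<in>{1..<k}. transp i k) \<otimes>\<^bsub>T n\<^esub> (\<Oplus>\<^bsub>T n\<^esub>i\<in>{1..<k}. transp i k)"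
      using finsum_closed[OF cl]
      by (simp add: jucys_murphy_eq[OF on k] numeral_2_eq_2 del: One_nat_def)
    also have "\<dots> = (\<Oplus>\<^bsub>T n\<^esub>p\<in>{1..<k} \<times> {1..<k}. F (k, p))"
      using finsum_times_finsum[OF _ _ cl cl] by (simp add: F_def case_prod_unfold)
    finally show ?thesis .
  qed
  then have "(\<Oplus>\<^bsub>T n\<^esub>k\<in>{1..n}. jucys_murphy n \<xi> k [^]\<^bsub>T n\<^esub> (2::nat)) =
      (\<Oplus>\<^bsub>T n\<^esub>k\<in>{1..n}. \<Oplus>\<^bsub>T n\<^esub>p\<in>{1..<k} \<times> {1..<k}. F (k, p))"
    using Fcl by (intro finsum_cong' refl) (auto intro!: finsum_closed)
  also have "\<dots> = (\<Oplus>\<^bsub>T n\<^esub>x\<in>?S. F x)"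
    using Fcl by (intro finsum_Sigma) auto
  also have "\<dots> = (\<Oplus>\<^bsub>T n\<^esub>x\<in>h ` inversion_pairs n. F x)"
    by (simp only: h)
  also have "\<dots> = (\<Oplus>\<^bsub>T n\<^esub>x\<in>inversion_pairs n. F (h x))"
    using Fcl by (intro finsum_reindex h(1)) (auto simp: h(2))
  also have "\<dots> = (\<Oplus>\<^bsub>T n\<^esub>p\<in>inversion_pairs n. case p of ((i, j), (k, l)) \<Rightarrow> transp i j \<otimes>\<^bsub>T n\<^esub> transp k l)"
  proof (rule finsum_cong'[OF refl])
    fix x assume "x \<in> inversion_pairs n"
    moreover obtain i j k l where x: "x = ((i, j), (k, l))"
      by (metis surj_pair)
    ultimately have ijkl: "1 \<le> i \<and> i < j \<and> j \<le> n \<and> (k = i \<and> i < l \<and> l \<le> j \<or> l = j \<and> i < k \<and> k < j)"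
      by (simp only: inversion_pairs_iff)
    show "F (h x) = (case x of ((i, j), (k, l)) \<Rightarrow> transp i j \<otimes>\<^bsub>T n\<^esub> transp k l)"
    proof (cases "k = i \<and> l < j")
      case True
      \<comment> \<open>Here \<open>F (h x)\<close> is
        \<open>transp l j \<otimes> transp i j\<close>, which the exchange identity equates with
        \<open>transp i j \<otimes> transp i l\<close>.\<close>
      with ijkl transp_exchange[of i l j] show ?thesis
        by (simp add: x F_def h_def)
    next
      case False
      \<comment> \<open>The remaining pairs, including the diagonal ones with \<open>k = i\<close>,
        share the upper index, so their products already are terms of the \<open>j\<close>-th
        square.\<close>
      with ijkl have "l = j" by auto
      with False show ?thesis
        by (simp add: x F_def h_def)
    qed
  qed (auto simp: inversion_pairs_iff)
  finally show ?thesis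
    by (simp only: casimir_eq[OF on])
qed

end
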